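(* Let $G$ be a finite $2$-connected chordal graph and let $\omega(G)$ denote its clique number. Then there exists a set $F \subseteq V(G)$ with $|F| \leq 2\lceil \omega(G)/3 \rceil$ such that $F$ intersects (the vertex set of) every longest cycle of $G$. Moreover, $F$ can be chosen so that it induces a clique in $G$.
   Context: A graph is chordal if every cycle on four or more vertices has a chord (equivalently, its only induced cycles are triangles). A longest cycle of $G$ is a cycle with the maximum number of vertices among all cycles of $G$. *)

theory Defs
  imports Complex_Main "Graph_Theory.Graph_Theory"
begin

text \<open>
  Finite simple undirected graphs are the members of the locale \<^locale>\<open>graph\<close>: finite symmetric
  digraphs without loops and without parallel arcs. An edge \<open>uv\<close> is represented by the two arcs
  \<open>(u, v)\<close> and \<open>(v, u)\<close>.
\<close>

text \<open>
  In a symmetric digraph, going back and forth along one edge is a \<^const>\<open>pre_digraph.cycle\<close> of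
  length 2. The bound on the length excludes exactly these (there are no loops), leaving the cycles
  of the undirected graph, each given with a starting vertex and an orientation.
\<close>
definition ucycle :: "('a, 'b) pre_digraph \<Rightarrow> 'b awalk \<Rightarrow> bool" where
  "ucycle G p \<longleftrightarrow> pre_digraph.cycle G p \<and> length p \<ge> 3"

definition cycle_verts :: "('a, 'b) pre_digraph \<Rightarrow> 'b awalk \<Rightarrow> 'a set" where
  "cycle_verts G p = tail G ` set p"

definition longest_cycle :: "('a, 'b) pre_digraph \<Rightarrow> 'b awalk \<Rightarrow> bool" where
  "longest_cycle G p \<longleftrightarrow>
     ucycle G p \<and> (\<forall>q. ucycle G q \<longrightarrow> card (cycle_verts G q) \<le> card (cycle_verts G p))"

definition has_chord :: "('a, 'b) pre_digraph \<Rightarrow> 'b awalk \<Rightarrow> bool" where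
  "has_chord G p \<longleftrightarrow>
     (\<exists>u \<in> cycle_verts G p. \<exists>v \<in> cycle_verts G p. u \<rightarrow>\<^bsub>G\<^esub> v \<and>
        (u, v) \<notin> arc_to_ends G ` set p \<and> (v, u) \<notin> arc_to_ends G ` set p)"

definition chordal :: "('a, 'b) pre_digraph \<Rightarrow> bool" where
  "chordal G \<longleftrightarrow> (\<forall>p. ucycle G p \<and> card (cycle_verts G p) \<ge> 4 \<longrightarrow> has_chord G p)"

definition k_connected :: "nat \<Rightarrow> ('a, 'b) pre_digraph \<Rightarrow> bool" where
  "k_connected k G \<longleftrightarrow> card (verts G) > k \<and>
     (\<forall>S \<subseteq> verts G. card S < k \<longrightarrow> connected (G \<restriction> (verts G - S)))"

definition clique :: "('a, 'b) pre_digraph \<Rightarrow> 'a set \<Rightarrow> bool" where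
  "clique G C \<longleftrightarrow> C \<subseteq> verts G \<and> (\<forall>u \<in> C. \<forall>v \<in> C. u \<noteq> v \<longrightarrow> u \<rightarrow>\<^bsub>G\<^esub> v)"

definition clique_number :: "('a, 'b) pre_digraph \<Rightarrow> nat" where
  "clique_number G = Max (card ` {C. clique G C})"

end

theory Submission
  imports Defs
begin

text \<open>
  Any two longest cycles of a 2-connected graph intersect, because two disjoint ones could be merged
  into a longer cycle along two disjoint paths.

  Let \<open>K\<close> be a clique with at most \<open>\<lceil>\<omega>/3\<rceil>\<close> vertices in each of three colours. If no clique of size
  \<open>2\<lceil>\<omega>/3\<rceil>\<close> meets all longest cycles, then for each colour there is a longest cycle meeting \<open>K\<close> in that
  colour only. At least two of these three cycles have all their edges incident with a single
  component of \<open>G - K\<close>: otherwise split the components into two groups that both divide each of two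
  such cycles, and glue the part of one cycle in the first group to the part of the other in the
  second group by edges of \<open>K\<close>, and vice versa. All vertices outside \<open>K\<close> are used once, but those in
  \<open>K\<close> twice, so one of the two new cycles is too long. The two cycles intersect outside \<open>K\<close>, so they
  select the same component \<open>D\<close>.

  Choose such a situation with \<open>D\<close> minimal. By chordality some vertex \<open>v\<close> of \<open>D\<close> is adjacent to all of
  the clique \<open>N(D)\<close>. Give \<open>v\<close> the rarest colour on \<open>N(D)\<close> and repeat the argument with
  \<open>N(D) \<union> {v}\<close>, which selects a component \<open>D'\<close>. By minimality \<open>D'\<close> is disjoint from \<open>D\<close>, but then two of the
  cycles at \<open>D\<close> and \<open>D'\<close> with different colours are disjoint, a contradiction.
\<close>

section \<open>Cyclic lists and counting by colours\<close>

definition cyclically :: "('a \<Rightarrow> 'a \<Rightarrow> bool) \<Rightarrow> 'a list \<Rightarrow> bool" where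
  "cyclically P w \<longleftrightarrow> successively P w \<and> (w \<noteq> [] \<longrightarrow> P (last w) (hd w))"

lemma cyclically_append_commute: "cyclically P (us @ vs) \<longleftrightarrow> cyclically P (vs @ us)"
  by (cases "us = []"; cases "vs = []") (auto simp: cyclically_def successively_append_iff)

lemma cyclically_mono:
  assumes "cyclically P w" "\<And>x y. x \<in> set w \<Longrightarrow> y \<in> set w \<Longrightarrow> P x y \<Longrightarrow> Q x y"
  shows "cyclically Q w"
  using assms unfolding cyclically_def by (auto intro: successively_mono)

lemma not_successivelyE:
  assumes "\<not> successively P w"
  obtains us x y vs where "w = us @ x # y # vs" "\<not> P x y"
proof -
  have "\<exists>us x y vs. w = us @ x # y # vs \<and> \<not> P x y"
    using assms
  proof (induction w rule: induct_list012)
    case (3 x y zs)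
    then show ?case
    proof (cases "P x y")
      case True
      then obtain us a b vs where "y # zs = us @ a # b # vs" "\<not> P a b"
        using 3 by auto
      then show ?thesis by (metis append_Cons)
    qed (metis append_Nil)
  qed auto
  then show thesis using that by blast
qed

text \<open>Rotating the list moves a violated pair to its two ends; there a cycle is later cut open
  into a path.\<close>

lemma not_cyclicallyE:
  assumes "\<not> cyclically P w"
  obtains us vs where "w = us @ vs" "w \<noteq> []" "\<not> P (last (vs @ us)) (hd (vs @ us))"
proof (cases "successively P w")
  case True
  then show thesis using assms that[of "[]" w] by (auto simp: cyclically_def)
next
  case False
  then obtain us x y vs where "w = us @ x # y # vs" "\<not> P x y" by (rule not_successivelyE)
  then show thesis using that[of "us @ [x]" "y # vs"] by auto
qed

lemma successively_conv_zip:
  "successively P (x # xs) \<and> P (last (x # xs)) y \<longleftrightarrow> (\<forall>(a, b) \<in> set (zip (x # xs) (xs @ [y])). P a b)"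
  by (induction xs arbitrary: x) auto

text \<open>The zip with the rotation lists the oriented edges of a cycle; in this form they are
  compared with arcs and chords.\<close>

lemma cyclically_conv_zip: "cyclically P w \<longleftrightarrow> (\<forall>(a, b) \<in> set (zip w (rotate1 w)). P a b)"
proof (cases w)
  case (Cons x xs)
  then show ?thesis using successively_conv_zip[of P x xs x] by (simp add: cyclically_def)
qed (simp add: cyclically_def)

text \<open>Serves to group components so that one grouping divides two cycles at once.\<close>

lemma split_two_pairs:
  assumes "a \<noteq> b" "c \<noteq> d"
  shows "\<exists>T. (a \<in> T \<longleftrightarrow> b \<notin> T) \<and> (c \<in> T \<longleftrightarrow> d \<notin> T)"
proof (cases "a \<in> {c, d}")
  case True
  then show ?thesis using assms by (intro exI[of _ "{a}"]) auto
next
  case False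
  then show ?thesis using assms by (intro exI[of _ "if c = b then {a, d} else {a, c}"]) auto
qed

lemma card_three_colours:
  fixes c :: "'b \<Rightarrow> nat"
  assumes "finite S" "\<And>x. c x < 3"
  shows "card S = card {s \<in> S. c s = 0} + card {s \<in> S. c s = 1} + card {s \<in> S. c s = 2}"
proof -
  have "c x = 0 \<or> c x = 1 \<or> c x = 2" for x using assms(2)[of x] by linarith
  then have "S = ({s \<in> S. c s = 0} \<union> {s \<in> S. c s = 1}) \<union> {s \<in> S. c s = 2}" by auto
  also have "card \<dots> = card ({s \<in> S. c s = 0} \<union> {s \<in> S. c s = 1}) + card {s \<in> S. c s = 2}"
    using assms(1) by (intro card_Un_disjoint) auto
  also have "card ({s \<in> S. c s = 0} \<union> {s \<in> S. c s = 1}) = card {s \<in> S. c s = 0} + card {s \<in> S. c s = 1}"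
    using assms(1) by (intro card_Un_disjoint) auto
  finally show ?thesis .
qed

section \<open>Paths, cycles and reachability in simple graphs\<close>

locale simple_graph =
  fixes V :: "'a set" and E :: "'a \<Rightarrow> 'a \<Rightarrow> bool"
  assumes finite_V: "finite V"
    and E_sym: "E u v \<Longrightarrow> E v u"
    and E_irrefl: "\<not> E u u"
    and E_V: "E u v \<Longrightarrow> u \<in> V"
begin

lemma E_V2: "E u v \<Longrightarrow> v \<in> V"
  using E_sym E_V by blast

definition path :: "'a list \<Rightarrow> bool" where
  "path p \<longleftrightarrow> p \<noteq> [] \<and> distinct p \<and> set p \<subseteq> V \<and> successively E p"

definition cyc :: "'a list \<Rightarrow> bool" where
  "cyc w \<longleftrightarrow> length w \<ge> 3 \<and> distinct w \<and> set w \<subseteq> V \<and> cyclically E w"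

definition longest :: "'a list \<Rightarrow> bool" where
  "longest w \<longleftrightarrow> cyc w \<and> (\<forall>w'. cyc w' \<longrightarrow> length w' \<le> length w)"

text \<open>Reflexivity extends to vertices outside \<open>D\<close>, so membership in
  \<open>D\<close> is stated separately where it matters.\<close>

definition reach :: "'a set \<Rightarrow> 'a \<Rightarrow> 'a \<Rightarrow> bool" where
  "reach D = (\<lambda>x y. E x y \<and> x \<in> D \<and> y \<in> D)\<^sup>*\<^sup>*"

definition nbs :: "'a set \<Rightarrow> 'a set" where
  "nbs D = {s \<in> V - D. \<exists>d \<in> D. E d s}"

definition complete :: "'a set \<Rightarrow> bool" where
  "complete K \<longleftrightarrow> K \<subseteq> V \<and> (\<forall>x \<in> K. \<forall>y \<in> K. x \<noteq> y \<longrightarrow> E x y)"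

text \<open>A condition on edges, not on vertices: the cycle may leave \<open>D\<close>, but never
  for two consecutive vertices.\<close>

definition inside :: "'a list \<Rightarrow> 'a set \<Rightarrow> bool" where
  "inside w D \<longleftrightarrow> cyclically (\<lambda>x y. x \<in> D \<or> y \<in> D) w"

lemma longestD: "longest w \<Longrightarrow> cyc w" "longest w \<Longrightarrow> cyc w' \<Longrightarrow> length w' \<le> length w"
  by (auto simp: longest_def)

lemma cyc_rotate: "cyc (us @ vs) \<longleftrightarrow> cyc (vs @ us)"
  by (auto simp: cyc_def cyclically_append_commute[of E us])

lemma cyc_append:
  assumes "path p" "path q" "set p \<inter> set q = {}" "E (last p) (hd q)" "E (last q) (hd p)"
    "length p + length q \<ge> 3"
  shows "cyc (p @ q)"
  using assms by (auto simp: cyc_def path_def cyclically_def successively_append_iff)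

lemma path_rev: "path p \<Longrightarrow> path (rev p)"
  by (auto simp: path_def intro: successively_mono E_sym)

lemma path_appendD: "path (p @ q) \<Longrightarrow> p \<noteq> [] \<Longrightarrow> path p" "path (p @ q) \<Longrightarrow> q \<noteq> [] \<Longrightarrow> path q"
  by (auto simp: path_def successively_append_iff)

lemma path_append:
  "path p \<Longrightarrow> path q \<Longrightarrow> set p \<inter> set q = {} \<Longrightarrow> E (last p) (hd q) \<Longrightarrow> path (p @ q)"
  by (auto simp: path_def successively_append_iff)

lemma reach_refl: "reach D x x"
  by (simp add: reach_def)

lemma reach_trans: "reach D x y \<Longrightarrow> reach D y z \<Longrightarrow> reach D x z"
  by (simp add: reach_def)

lemma reach_step: "reach D x y \<Longrightarrow> E y z \<Longrightarrow> y \<in> D \<Longrightarrow> z \<in> D \<Longrightarrow> reach D x z"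
  unfolding reach_def by (rule rtranclp.rtrancl_into_rtrancl) auto

lemma reach_sym:
  assumes "reach D x y" shows "reach D y x"
proof -
  have "symp (\<lambda>x y. E x y \<and> x \<in> D \<and> y \<in> D)"
    using E_sym by (auto simp: symp_def)
  then show ?thesis
    using assms unfolding reach_def by (meson symp_rtranclp sympD)
qed

lemma reach_closed:
  assumes "reach D x y" "x \<in> X" "\<And>a b. E a b \<Longrightarrow> a \<in> D \<Longrightarrow> b \<in> D \<Longrightarrow> a \<in> X \<Longrightarrow> b \<in> X"
  shows "y \<in> X"
  using assms(1,2) unfolding reach_def by (induction rule: rtranclp_induct) (use assms(3) in auto)

lemma reach_path:
  assumes "reach D x y" "x \<in> D" "D \<subseteq> V"
  shows "\<exists>p. path p \<and> hd p = x \<and> last p = y \<and> set p \<subseteq> D"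
  using assms(1) unfolding reach_def
proof (induction rule: rtranclp_induct)
  case base
  show ?case by (rule exI[of _ "[x]"]) (use assms in \<open>auto simp: path_def\<close>)
next
  case (step y z)
  then obtain p where p: "path p" "hd p = x" "last p = y" "set p \<subseteq> D" by blast
  show ?case
  proof (cases "z \<in> set p")
    case True
    then obtain p1 p2 where "p = p1 @ z # p2" by (meson split_list)
    then have "path (p1 @ [z])" "hd (p1 @ [z]) = x"
      using p path_appendD(1)[of "p1 @ [z]" p2] by (auto simp: hd_append)
    then show ?thesis using p \<open>p = _\<close> by (intro exI[of _ "p1 @ [z]"]) auto
  next
    case False
    then have "path (p @ [z])"
      using p step assms(3) by (intro path_append) (auto simp: path_def)
    then show ?thesis using p step by (intro exI[of _ "p @ [z]"]) (auto simp: path_def)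
  qed
qed

text \<open>Menger's theorem for two paths, by induction along a path from \<open>A\<close> to \<open>x\<close>: of a third path that
  avoids \<open>x\<close>, the part after its last contact with \<open>A\<close> and the two paths already found is kept.\<close>
lemma two_disjoint_paths:
  assumes conn2: "\<And>x y z. \<lbrakk>x \<in> V; y \<in> V - {x}; z \<in> V - {x}\<rbrakk> \<Longrightarrow> reach (V - {x}) y z"
    and A: "A \<subseteq> V" "a \<in> A" "a' \<in> A" "a \<noteq> a'"
    and x: "reach V a x" and z: "z \<in> V" "z \<noteq> x"
  shows "\<exists>p q. path p \<and> path q \<and> hd p \<in> A \<and> last p = x \<and> hd q \<in> A \<and> last q = z \<and>
    set p \<inter> set q = {}"
  using x z unfolding reach_def
proof (induction arbitrary: z rule: rtranclp_induct)
  case base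
  then obtain q where "path q" "hd q = a'" "last q = z" "set q \<subseteq> V - {a}"
    using reach_path[OF conn2[of a a' z]] A by auto
  moreover have "path [a]" using A by (auto simp: path_def)
  ultimately show ?case using A by (intro exI[of _ "[a]"] exI[of _ q]) auto
next
  case (step x' x)
  have "x \<noteq> x'" "x \<in> V" "x' \<in> V" using step.hyps E_irrefl by auto
  \<comment> \<open>With \<open>x\<close> as second target the induction hypothesis gives disjoint
    paths to \<open>x'\<close> and \<open>x\<close>; they are rerouted to end in \<open>x\<close>
    and \<open>z\<close>.\<close>
  then obtain p q where p: "path p" "hd p \<in> A" "last p = x'" and q: "path q" "hd q \<in> A" "last q = x"
    and pq: "set p \<inter> set q = {}"
    using step.IH[of x] by auto
  have ne: "p \<noteq> []" "q \<noteq> []" using p q by (auto simp: path_def)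
  obtain b where b: "b \<in> A" "b \<noteq> x" using A by metis
  then obtain r where r: "path r" "hd r = b" "last r = z" "set r \<subseteq> V - {x}"
    using reach_path[OF conn2[of x b z]] A step.prems \<open>x \<in> V\<close> by auto
  have "hd r \<in> set r" using r(1) by (intro hd_in_set) (simp add: path_def)
  then have "\<exists>y \<in> set r. y \<in> set p \<union> set q \<union> A" using r b by auto
  then obtain r1 y r2 where r12: "r = r1 @ y # r2" "y \<in> set p \<union> set q \<union> A"
    "\<forall>u \<in> set r2. u \<notin> set p \<union> set q \<union> A"
    by (rule split_list_last_propE)
  have yr: "path (y # r2)" "last (y # r2) = z" "y \<noteq> x"
    using r r12 path_appendD(2)[of r1 "y # r2"] by auto
  have extend: "\<exists>s1. path (s1 @ y # r2) \<and> hd (s1 @ y # r2) \<in> A \<and> set s1 \<subseteq> set s - {last s}"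
    if s_in: "path s" "hd s \<in> A" "y \<in> set s" "set s \<inter> set r2 = {}" "last s \<noteq> y" for s
  proof -
    obtain s1 s2 where s: "s = s1 @ y # s2" using s_in(3) by (meson split_list)
    then have "s2 \<noteq> []" using that by auto
    then have "last s \<in> set s2" using s by auto
    then have "last s \<notin> set s1" using that(1) s by (auto simp: path_def)
    moreover have "path (s1 @ [y] @ r2)"
      using that(1,4) s yr(1) by (auto simp: path_def successively_append_iff successively_Cons)
    moreover have "hd (s1 @ y # r2) \<in> A" using that(2) s by (cases s1) auto
    ultimately show ?thesis using s by (intro exI[of _ s1]) auto
  qed
  have "last q \<in> set q" using ne by simp
  then have xq: "x \<in> set q" "x \<notin> set p" using q pq by auto
  have px: "path (p @ [x])" "hd (p @ [x]) \<in> A"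
    using p xq step.hyps ne \<open>x \<in> V\<close> by (auto intro!: path_append simp: path_def[of "[x]"])
  have xr: "x \<notin> set r2" "x \<noteq> y" using r r12 by auto
  consider "y \<in> set p" | "y \<in> set q" | "y \<in> A" "y \<notin> set p" "y \<notin> set q" using r12(2) by blast
  then show ?case
  proof cases
    case 1
    \<comment> \<open>\<open>extend\<close> is applied to \<open>p @ [x]\<close> instead of
      \<open>p\<close>, since \<open>y\<close> may be the last vertex of \<open>p\<close>.\<close>
    obtain s1 where "path (s1 @ y # r2)" "hd (s1 @ y # r2) \<in> A" "set s1 \<subseteq> set (p @ [x]) - {x}"
      using extend[OF px] 1 r12(3) xr by auto
    then show ?thesis
      using q pq yr r12(3) 1 by (intro exI[of _ q] exI[of _ "s1 @ y # r2"]) auto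
  next
    case 2
    obtain s1 where "path (s1 @ y # r2)" "hd (s1 @ y # r2) \<in> A" "set s1 \<subseteq> set q - {x}"
      using extend[OF q(1,2)] 2 q(3) r12(3) xr by auto
    then show ?thesis
      using px pq yr r12(3) 2 xr by (intro exI[of _ "p @ [x]"] exI[of _ "s1 @ y # r2"]) auto
  next
    case 3
    then show ?thesis
      using q yr r12(3) by (intro exI[of _ q] exI[of _ "y # r2"]) auto
  qed
qed


section \<open>Assembling cycles from paths and arcs\<close>

lemma path_join:
  "path (p @ [b]) \<Longrightarrow> path s \<Longrightarrow> hd s = b \<Longrightarrow> set p \<inter> set s = {} \<Longrightarrow> path (p @ s)"
  by (auto simp: path_def successively_append_iff)

lemma cyc_close:
  assumes "path p" "path (last p # q @ [hd p])" "set p \<inter> set q = {}" "length p \<ge> 3"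
  shows "cyc (p @ q)"
  using assms
  by (cases "q = []") (auto simp: cyc_def path_def cyclically_def successively_append_iff successively_Cons)

text \<open>The piece from the last contact with \<open>A\<close> to the first later contact with
  \<open>B\<close> has an interior free of both.\<close>

lemma path_between:
  assumes "path p" "hd p \<in> A" "last p \<in> B" "A \<inter> B = {}"
  obtains a m b where "path (a # m @ [b])" "a \<in> A" "b \<in> B" "set (a # m @ [b]) \<subseteq> set p"
    "set m \<inter> (A \<union> B) = {}"
proof -
  have ne: "p \<noteq> []" using assms by (simp add: path_def)
  then have "\<exists>x \<in> set p. x \<in> A" using assms by (intro bexI[of _ "hd p"]) auto
  then obtain p1 a p2 where p: "p = p1 @ a # p2" "a \<in> A" "\<forall>x \<in> set p2. x \<notin> A"
    by (rule split_list_last_propE)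
  then have "p2 \<noteq> []" using assms by auto
  then have "\<exists>x \<in> set p2. x \<in> B" using assms p by (intro bexI[of _ "last p2"]) auto
  then obtain m b q where q: "p2 = m @ b # q" "b \<in> B" "\<forall>x \<in> set m. x \<notin> B"
    by (rule split_list_first_propE)
  have "path (a # m @ [b])"
    using assms(1) p q path_appendD(1)[of "a # m @ [b]" q] path_appendD(2)[of p1 "a # p2"] by simp
  then show thesis using p q by (intro that[of a m b]) auto
qed

text \<open>The two arcs between \<open>a\<close> and \<open>b\<close> share exactly these vertices,
  so their lengths add up to \<open>length w + 2\<close> and the longer one qualifies.\<close>

lemma long_arc:
  assumes "cyc w" "a \<in> set w" "b \<in> set w" "a \<noteq> b"
  obtains s where "path s" "hd s = a" "last s = b" "set s \<subseteq> set w" "2 * length s \<ge> length w + 2"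
proof -
  obtain w1 w2 where w: "w = w1 @ a # w2" using assms(2) by (meson split_list)
  have c: "cyc (a # w2 @ w1)" using assms(1) cyc_rotate[of w1 "a # w2"] w by simp
  have "b \<in> set (w2 @ w1)" using assms w by auto
  then obtain u v where uv: "w2 @ w1 = u @ b # v" by (meson split_list)
  have "path (a # u @ [b])" "path (b # v @ [a])"
    using c unfolding uv
    by (auto simp: cyc_def path_def cyclically_def successively_append_iff successively_Cons hd_append
        split: if_splits)
  moreover from this(2) have "path (rev (b # v @ [a]))" by (rule path_rev)
  moreover have "length w = length u + length v + 2"
    using arg_cong[OF uv, of length] w by simp
  moreover have "set w = {a, b} \<union> set u \<union> set v"
    using arg_cong[OF uv, of set] w by auto
  ultimately show thesis
    using that[of "a # u @ [b]"] that[of "rev (b # v @ [a])"] by (cases "length u \<ge> length v") auto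
qed

section \<open>Components outside a vertex set\<close>

definition component :: "'a set \<Rightarrow> 'a \<Rightarrow> 'a set" where
  "component K x = {y. reach (- K) x y}"

lemma component_eqI: "y \<in> component K x \<Longrightarrow> component K y = component K x"
  unfolding component_def using reach_trans reach_sym by blast

lemma component_self: "x \<in> component K x"
  by (simp add: component_def reach_refl)

lemma component_adj:
  assumes "E x y" "x \<notin> K" "y \<notin> K"
  shows "component K x = component K y"
proof -
  have "y \<in> component K x" using reach_step[OF reach_refl assms(1)] assms by (simp add: component_def)
  then show ?thesis using component_eqI by blast
qed

lemma component_subset:
  assumes "x \<in> V - K"
  shows "component K x \<subseteq> V - K"
proof
  fix y assume "y \<in> component K x"
  then have "reach (- K) x y" by (simp add: component_def)
  then show "y \<in> V - K" by (rule reach_closed) (use assms E_V2 in auto)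
qed

lemma nbs_component:
  assumes "x \<in> V - K"
  shows "nbs (component K x) \<subseteq> K"
proof (rule subsetI, rule ccontr)
  fix s assume "s \<in> nbs (component K x)" "s \<notin> K"
  then obtain d where d: "d \<in> component K x" "E d s" "s \<notin> component K x" by (auto simp: nbs_def)
  then have "component K d = component K s" using component_subset[OF assms] \<open>s \<notin> K\<close> by (intro component_adj) auto
  then show False using d component_eqI[OF d(1)] component_self[of s K] by simp
qed

text \<open>A walk that avoids \<open>K\<close> never leaves the component of its first vertex, so
  reachability in \<open>- K\<close> restricts to the component.\<close>

lemma component_connected:
  assumes "y \<in> component K x" "z \<in> component K x"
  shows "reach (component K x) y z"
proof -
  have *: "reach (component K x) x u" if "u \<in> component K x" for u
    using that unfolding component_def mem_Collect_eq
    unfolding reach_def[of "- K"]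
  proof (induction rule: rtranclp_induct)
    case (step u v)
    then have "u \<in> component K x" "v \<in> component K x"
      by (auto simp: component_def reach_def intro: rtranclp.rtrancl_into_rtrancl)
    then show ?case using step reach_step[of "component K x" x u v] by (auto simp: component_def reach_def)
  qed (simp add: reach_refl)
  show ?thesis using *[OF assms(1)] *[OF assms(2)] reach_sym reach_trans by blast
qed

section \<open>Cycles relative to a vertex set, and splicing along a clique\<close>

lemma inside_subset:
  assumes "cyc w" "inside w D"
  shows "set w \<subseteq> D \<union> nbs D"
proof
  fix z assume "z \<in> set w"
  then obtain us vs where w: "w = us @ z # vs" by (meson split_list)
  have "cyc (z # vs @ us)" "inside (z # vs @ us) D"
    using assms w cyc_rotate[of us "z # vs"] cyclically_append_commute[of _ us "z # vs"]
    by (auto simp: inside_def)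
  moreover from this(1) obtain y ys where "vs @ us = y # ys" by (cases "vs @ us") (auto simp: cyc_def)
  ultimately have "E z y" "z \<in> D \<or> y \<in> D"
    by (auto simp: cyc_def inside_def cyclically_def)
  then show "z \<in> D \<union> nbs D" using E_sym E_V by (auto simp: nbs_def)
qed

text \<open>The second conjunct carries the induction. The vertices before and after a deleted
  stretch lie in \<open>K\<close> by the boundary hypothesis; being distinct members of a clique,
  they are adjacent.\<close>

lemma filter_clique:
  assumes "successively E w" "distinct w" "complete K"
    and "\<And>x y. E x y \<Longrightarrow> x \<in> M \<Longrightarrow> y \<notin> M \<Longrightarrow> x \<in> K"
  shows "successively E (filter (\<lambda>x. x \<in> M) w) \<and>
    (w \<noteq> [] \<and> hd w \<notin> M \<and> filter (\<lambda>x. x \<in> M) w \<noteq> [] \<longrightarrow> hd (filter (\<lambda>x. x \<in> M) w) \<in> K)"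
  using assms(1,2)
proof (induction w)
  case (Cons x w)
  let ?f = "filter (\<lambda>x. x \<in> M)"
  show ?case
  proof (cases w)
    case Nil
    then show ?thesis by simp
  next
    case w: (Cons y ys)
    have IH: "successively E (?f w)" "y \<notin> M \<Longrightarrow> ?f w \<noteq> [] \<Longrightarrow> hd (?f w) \<in> K"
      using Cons w by auto
    have xy: "E x y" using Cons.prems w by simp
    show ?thesis
    proof (cases "x \<in> M")
      case False
      have "hd (?f w) \<in> K" if "?f w \<noteq> []"
        using that IH(2) assms(4)[OF E_sym[OF xy] _ False] w by (cases "y \<in> M") auto
      then show ?thesis using False IH by simp
    next
      case True
      have "E x (hd (?f w))" if "?f w \<noteq> []"
      proof (cases "y \<in> M")
        case True
        then show ?thesis using xy w by simp
      next
        case False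
        have "hd (?f w) \<in> set (?f w)" using that by (rule hd_in_set)
        then have "x \<noteq> hd (?f w)" using Cons.prems by auto
        then show ?thesis
          using assms(3) assms(4)[OF xy True False] IH(2)[OF False that] by (auto simp: complete_def)
      qed
      then show ?thesis using True IH by (auto simp: successively_Cons)
    qed
  qed
qed simp

text \<open>Deleting components of \<open>G - K\<close> from a cycle cuts it into segments with both ends in \<open>K\<close>; the
  edges of the clique \<open>K\<close> link these up again in their cyclic order, so that filtering suffices.\<close>
lemma restrict_cycle_to_path:
  assumes "cyc w" "complete K" "K \<subseteq> M"
    and bnd: "\<And>x y. E x y \<Longrightarrow> x \<in> M \<Longrightarrow> y \<notin> M \<Longrightarrow> x \<in> K"
    and ne: "set w \<inter> K \<noteq> {}"
    and cut: "\<not> set w \<subseteq> M \<or> \<not> cyclically (\<lambda>x y. x \<notin> K \<or> y \<notin> K) w"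
  obtains p where "path p" "set p = set w \<inter> M" "hd p \<in> K" "last p \<in> K"
proof -
  let ?f = "filter (\<lambda>x. x \<in> M)"
  have fpath: "path (?f u)" if "cyc u" "set u = set w" for u
    using that assms filter_clique[of u K M] by (auto simp: path_def cyc_def cyclically_def filter_empty_conv)
  show thesis
  proof (cases "set w \<subseteq> M")
    case False
    then obtain us x vs where w: "w = us @ x # vs" "x \<notin> M" by (meson split_list subsetI)
    \<comment> \<open>With a deleted vertex \<open>x\<close> rotated to the front,
      \<open>filter_clique\<close> puts the head of the filtered list into \<open>K\<close>; applied
      to the reversal of \<open>u @ [x]\<close>, it does the same for the last entry.\<close>
    define u where "u = vs @ us"
    have c: "cyc (x # u)" "cyc (u @ [x])"
      using assms(1) w cyc_rotate[of us "x # vs"] cyc_rotate[of "us @ [x]" vs] by (auto simp: u_def)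
    have P: "path (?f (x # u))" using fpath[OF c(1)] w by (auto simp: u_def)
    moreover have "hd (?f (x # u)) \<in> K"
      using filter_clique[of "x # u" K M] P c(1) assms(2) bnd w(2)
      by (auto simp: path_def cyc_def cyclically_def)
    moreover have "hd (?f (rev (u @ [x]))) \<in> K"
    proof -
      have "successively E (rev (u @ [x]))" "distinct (rev (u @ [x]))"
        using c(2) E_sym by (auto simp: cyc_def cyclically_def simp del: rev_append intro: successively_mono)
      moreover have "?f (rev (u @ [x])) \<noteq> []" using P w(2) by (auto simp: path_def rev_filter[symmetric])
      ultimately show ?thesis using filter_clique[of "rev (u @ [x])" K M] assms(2) bnd w(2) by auto
    qed
    then have "last (?f (x # u)) \<in> K" using w(2) by (simp add: rev_filter[symmetric] hd_rev)
    ultimately show thesis using that[of "?f (x # u)"] w by (auto simp: u_def)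
  next
    case True
    \<comment> \<open>Nothing is deleted, so the cycle is opened at an edge with both ends in
      \<open>K\<close>.\<close>
    then obtain us vs where u: "w = us @ vs" "w \<noteq> []" "last (vs @ us) \<in> K" "hd (vs @ us) \<in> K"
      using cut not_cyclicallyE[of "\<lambda>x y. x \<notin> K \<or> y \<notin> K" w] by metis
    then have "cyc (vs @ us)" using assms(1) cyc_rotate by simp
    then have "path (vs @ us)" by (auto simp: cyc_def path_def cyclically_def)
    then show thesis using u True that[of "vs @ us"] by auto
  qed
qed

text \<open>\<open>U\<close> never separates adjacent vertices outside \<open>K\<close>, so it
  groups whole components. By \<open>cut\<close>, restricting either cycle to
  \<open>K \<union> U\<close> or to \<open>K \<union> - U\<close> leaves a path with ends in
  \<open>K\<close>; opposite paths of different cycles are disjoint, and two edges of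
  \<open>K\<close> close them up.\<close>

lemma splice_longest_cycles:
  assumes K: "complete K" and w: "longest w1" "longest w2" and disj: "set w1 \<inter> set w2 \<inter> K = {}"
    and U: "\<And>x y. E x y \<Longrightarrow> x \<notin> K \<Longrightarrow> y \<notin> K \<Longrightarrow> x \<in> U \<longleftrightarrow> y \<in> U"
    and ne: "set w1 \<inter> K \<noteq> {}" "set w2 \<inter> K \<noteq> {}"
    and cut: "\<And>w. w \<in> {w1, w2} \<Longrightarrow> \<not> cyclically (\<lambda>x y. x \<notin> K \<or> y \<notin> K) w \<or>
      (\<exists>x \<in> set w - K. x \<in> U) \<and> (\<exists>x \<in> set w - K. x \<notin> U)"
  shows False
proof -
  have paths: "\<exists>p. path p \<and> set p = set w \<inter> (K \<union> X) \<and> hd p \<in> K \<and> last p \<in> K"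
    if "w \<in> {w1, w2}" "X = U \<or> X = - U" for w X
  proof -
    have "cyc w" "set w \<inter> K \<noteq> {}" using that(1) ne longestD(1) w by auto
    moreover have "\<not> set w \<subseteq> K \<union> X \<or> \<not> cyclically (\<lambda>x y. x \<notin> K \<or> y \<notin> K) w"
      using cut[OF that(1)] that(2) by auto
    moreover have "x \<in> K" if "E x y" "x \<in> K \<union> X" "y \<notin> K \<union> X" for x y
      using that U[of x y] \<open>X = U \<or> X = - U\<close> by auto
    ultimately show ?thesis using restrict_cycle_to_path[of w K "K \<union> X"] K by blast
  qed
  \<comment> \<open>The vertices of \<open>K\<close> on the cycle, of which there is at least one,
    lie on both paths.\<close>
  have len: "length p + length q > length w"
    if "w \<in> {w1, w2}" "path p" "path q" "set p = set w \<inter> (K \<union> U)" "set q = set w \<inter> (K \<union> - U)"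
    for w p q
  proof -
    have "distinct w" "set w \<inter> K \<noteq> {}" using that(1) ne longestD(1) w by (auto simp: cyc_def)
    then have "card (set w \<inter> K) > 0" by (simp add: card_gt_0_iff)
    moreover have "set p \<union> set q = set w" "set p \<inter> set q = set w \<inter> K" using that by auto
    ultimately show ?thesis
      using card_Un_Int[of "set p" "set q"] that(2,3) \<open>distinct w\<close> by (simp add: path_def distinct_card)
  qed
  \<comment> \<open>Fewer than three vertices form no cycle; this alternative does no harm, as
    longest cycles have length at least 3.\<close>
  have join: "length p + length q \<le> length w1 \<or> length p + length q < 3"
    if "path p" "path q" "set p = set w1 \<inter> (K \<union> X)" "set q = set w2 \<inter> (K \<union> - X)"
      "hd p \<in> K" "last p \<in> K" "hd q \<in> K" "last q \<in> K" for p q X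
  proof -
    have d: "set p \<inter> set q = {}" using that disj by auto
    have "hd p \<in> set p" "last p \<in> set p" "hd q \<in> set q" "last q \<in> set q"
      using that(1,2) by (auto simp: path_def intro: hd_in_set)
    then have "E (last p) (hd q)" "E (last q) (hd p)"
      using K that d unfolding complete_def by (metis disjoint_iff)+
    then have "length p + length q < 3 \<or> cyc (p @ q)" using cyc_append that d by force
    then show ?thesis using longestD(2)[OF w(1)] by force
  qed
  obtain p p' q q' where
    p: "path p" "set p = set w1 \<inter> (K \<union> U)" "hd p \<in> K" "last p \<in> K" and
    p': "path p'" "set p' = set w1 \<inter> (K \<union> - U)" "hd p' \<in> K" "last p' \<in> K" and
    q: "path q" "set q = set w2 \<inter> (K \<union> U)" "hd q \<in> K" "last q \<in> K" and
    q': "path q'" "set q' = set w2 \<inter> (K \<union> - U)" "hd q' \<in> K" "last q' \<in> K"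
    using paths[of w1 U] paths[of w1 "- U"] paths[of w2 U] paths[of w2 "- U"] by auto
  have "length p + length p' > length w1" "length q + length q' > length w2"
    using len[of w1 p p'] len[of w2 q q'] p p' q q' by auto
  moreover have "length w1 = length w2" using w by (simp add: longest_def le_antisym)
  moreover have "length w1 \<ge> 3" using w by (simp add: longest_def cyc_def)
  moreover note join[of p q' U] join[of p' q "- U"]
  ultimately show False using p p' q q' by auto
qed

text \<open>With no edge in \<open>K\<close> and all outer vertices in one component, the cycle
  would be inside that component. If it missed \<open>K\<close>, it would have no edge in
  \<open>K\<close> and its edges would keep it in one component.\<close>

lemma not_inside_componentD:
  assumes "cyc w" "\<And>x. x \<in> V - K \<Longrightarrow> \<not> inside w (component K x)"
  shows "set w \<inter> K \<noteq> {}"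
    and "\<not> cyclically (\<lambda>x y. x \<notin> K \<or> y \<notin> K) w \<or>
      (\<exists>x \<in> set w - K. \<exists>y \<in> set w - K. component K x \<noteq> component K y)"
proof -
  have w: "w \<noteq> []" "set w \<subseteq> V" "cyclically E w" using assms(1) by (auto simp: cyc_def)
  show *: "\<not> cyclically (\<lambda>x y. x \<notin> K \<or> y \<notin> K) w \<or>
      (\<exists>x \<in> set w - K. \<exists>y \<in> set w - K. component K x \<noteq> component K y)"
  proof (rule ccontr)
    assume "\<not> ?thesis"
    then have c: "cyclically (\<lambda>x y. x \<notin> K \<or> y \<notin> K) w"
      and eq: "\<And>x y. x \<in> set w - K \<Longrightarrow> y \<in> set w - K \<Longrightarrow> component K x = component K y" by blast+
    have "last w \<notin> K \<or> hd w \<notin> K" using c w by (simp add: cyclically_def)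
    moreover have "hd w \<in> set w" "last w \<in> set w" using w by auto
    ultimately obtain x where x: "x \<in> set w - K" by blast
    have "y \<in> component K x" if "y \<in> set w - K" for y using eq[OF x that] component_self by blast
    then have "inside w (component K x)"
      unfolding inside_def by (intro cyclically_mono[OF c]) auto
    then show False using assms(2)[of x] x w by auto
  qed
  have same: "component K x = component K (hd u)" if "successively E u" "set u \<inter> K = {}" "x \<in> set u" for u x
    using that
  proof (induction u)
    case (Cons a u)
    show ?case
    proof (cases "x = a")
      case False
      then have u: "u \<noteq> []" "x \<in> set u" using Cons.prems by auto
      then have "component K x = component K (hd u)" using Cons by (simp add: successively_Cons)
      moreover have "set u \<inter> K = {}" using Cons.prems by auto
      then have "hd u \<notin> K" using hd_in_set[OF u(1)] by blast
      then have "component K a = component K (hd u)"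
        using Cons.prems u by (intro component_adj) (auto simp: successively_Cons)
      ultimately show ?thesis by simp
    qed simp
  qed simp
  show "set w \<inter> K \<noteq> {}"
  proof
    assume e: "set w \<inter> K = {}"
    then have "cyclically (\<lambda>x y. x \<notin> K \<or> y \<notin> K) w"
      by (intro cyclically_mono[OF w(3)]) auto
    then obtain x y where xy: "x \<in> set w" "y \<in> set w" "component K x \<noteq> component K y" using * by blast
    have "successively E w" using w(3) by (simp add: cyclically_def)
    then show False using same[OF _ e xy(1)] same[OF _ e xy(2)] xy(3) by simp
  qed
qed

text \<open>If both fail, each cycle either has an edge in \<open>K\<close>, where any grouping of
  components will do, or meets two components, which the grouping has to divide.
  \<open>split_two_pairs\<close> handles two cycles of the latter kind.\<close>

lemma longest_cycle_inside_component:
  assumes K: "complete K" and w: "longest w1" "longest w2" and disj: "set w1 \<inter> set w2 \<inter> K = {}"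
  shows "\<exists>w \<in> {w1, w2}. \<exists>x \<in> V - K. inside w (component K x)"
proof (rule ccontr)
  assume "\<not> ?thesis"
  then have n: "\<not> inside w1 (component K x)" "\<not> inside w2 (component K x)" if "x \<in> V - K" for x
    using that by auto
  note n1 = not_inside_componentD[OF longestD(1)[OF w(1)] n(1)]
  note n2 = not_inside_componentD[OF longestD(1)[OF w(2)] n(2)]
  let ?kk = "\<lambda>w. \<not> cyclically (\<lambda>x y. x \<notin> K \<or> y \<notin> K) w"
  let ?split = "\<lambda>T w. (\<exists>x \<in> set w - K. component K x \<in> T) \<and> (\<exists>x \<in> set w - K. component K x \<notin> T)"
  let ?two = "\<lambda>w. \<exists>x \<in> set w - K. \<exists>y \<in> set w - K. component K x \<noteq> component K y"
  have one: "\<exists>T. ?split T w" if "?two w" for w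
    using that by (metis singleton_iff)
  have two: "\<exists>T. ?split T w \<and> ?split T w'"
    if ww': "?two w" "?two w'" for w w'
  proof -
    obtain x y x' y' where x: "x \<in> set w - K" "y \<in> set w - K" "component K x \<noteq> component K y"
      and x': "x' \<in> set w' - K" "y' \<in> set w' - K" "component K x' \<noteq> component K y'"
      using ww' by blast
    obtain T where "component K x \<in> T \<longleftrightarrow> component K y \<notin> T" "component K x' \<in> T \<longleftrightarrow> component K y' \<notin> T"
      using split_two_pairs[OF x(3) x'(3)] by blast
    then show ?thesis using x(1,2) x'(1,2) by blast
  qed
  have "\<exists>T. (?kk w1 \<or> ?split T w1) \<and> (?kk w2 \<or> ?split T w2)"
  proof (cases "?kk w1 \<or> ?kk w2")
    case True
    then show ?thesis using n1(2) n2(2) one[of w1] one[of w2] by blast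
  next
    case False
    then show ?thesis using n1(2) n2(2) two[of w1 w2] by blast
  qed
  then obtain T where "\<And>w. w \<in> {w1, w2} \<Longrightarrow> ?kk w \<or> ?split T w" by blast
  then show False
    using splice_longest_cycles[OF K w disj _ n1(1) n2(1), of "{x. component K x \<in> T}"] component_adj by simp
qed

end

section \<open>Longest cycles and dominating vertices in two-connected chordal graphs\<close>

locale biconnected_chordal = simple_graph +
  assumes conn1: "x \<in> V \<Longrightarrow> y \<in> V \<Longrightarrow> reach V x y"
    and conn2: "x \<in> V \<Longrightarrow> y \<in> V - {x} \<Longrightarrow> z \<in> V - {x} \<Longrightarrow> reach (V - {x}) y z"
    and chord: "cyc w \<Longrightarrow> length w \<ge> 4 \<Longrightarrow> \<exists>u \<in> set w. \<exists>v \<in> set w. E u v \<and>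
      (u, v) \<notin> set (zip w (rotate1 w)) \<and> (v, u) \<notin> set (zip w (rotate1 w))"
begin

text \<open>The longer arcs between the ends of the two connecting paths have together at least
  \<open>length w1 + 2\<close> vertices, so the merged cycle is too long.\<close>

lemma longest_cycles_intersect:
  assumes w: "longest w1" "longest w2"
  shows "set w1 \<inter> set w2 \<noteq> {}"
proof
  assume disj: "set w1 \<inter> set w2 = {}"
  have two: "\<exists>x y. x \<in> set w \<and> y \<in> set w \<and> x \<noteq> y" if cw: "cyc w" for w
  proof -
    obtain x y zs where "w = x # y # zs" using cw by (cases w; cases "tl w") (auto simp: cyc_def)
    then show ?thesis using cw by (intro exI[of _ x] exI[of _ y]) (auto simp: cyc_def)
  qed
  have c: "cyc w1" "cyc w2" using w longestD by auto
  obtain a a' where a: "a \<in> set w1" "a' \<in> set w1" "a \<noteq> a'" using two[OF c(1)] by blast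
  obtain x z where x: "x \<in> set w2" "z \<in> set w2" "z \<noteq> x" using two[OF c(2)] by blast
  have V: "set w1 \<subseteq> V" "set w2 \<subseteq> V" using c by (auto simp: cyc_def)
  obtain p q where p: "path p" "hd p \<in> set w1" "last p \<in> set w2"
    and q: "path q" "hd q \<in> set w1" "last q \<in> set w2" and pq: "set p \<inter> set q = {}"
    using two_disjoint_paths[OF conn2 V(1) a conn1, of x z] a x V by blast
  obtain a1 m b1 where m: "path (a1 # m @ [b1])" "a1 \<in> set w1" "b1 \<in> set w2"
    "set (a1 # m @ [b1]) \<subseteq> set p" "set m \<inter> (set w1 \<union> set w2) = {}"
    using path_between[OF p disj] by blast
  obtain a2 n b2 where n: "path (a2 # n @ [b2])" "a2 \<in> set w1" "b2 \<in> set w2"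
    "set (a2 # n @ [b2]) \<subseteq> set q" "set n \<inter> (set w1 \<union> set w2) = {}"
    using path_between[OF q disj] by blast
  have ne: "a2 \<noteq> a1" "b1 \<noteq> b2" using m(4) n(4) pq by auto
  obtain s where s: "path s" "hd s = a2" "last s = a1" "set s \<subseteq> set w1" "2 * length s \<ge> length w1 + 2"
    using long_arc[OF c(1) n(2) m(2) ne(1)] by blast
  obtain t where t: "path t" "hd t = b1" "last t = b2" "set t \<subseteq> set w2" "2 * length t \<ge> length w2 + 2"
    using long_arc[OF c(2) m(3) n(3) ne(2)] by blast
  have sn: "s \<noteq> []" "t \<noteq> []" using s t by (auto simp: path_def)
  \<comment> \<open>The arc \<open>s\<close> ends in \<open>a1\<close>, where the first connecting
    path starts; one copy is dropped before joining.\<close>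
  have "s = butlast s @ [a1]" using s sn append_butlast_last_id by metis
  then obtain s' where s': "s = s' @ [a1]" by blast
  have "path ((a1 # m) @ t)" using path_join[of "a1 # m" b1 t] m t s(4) disj by auto
  then have "path (s' @ a1 # m @ t)"
    using path_join[of s' a1 "a1 # m @ t"] s s' m(5) t(4) disj by (auto simp: path_def)
  then have st: "path (s @ m @ t)" using s' by simp
  \<comment> \<open>The second connecting path, run backwards from \<open>b2\<close> to
    \<open>a2\<close>, closes the cycle.\<close>
  have "path (rev (a2 # n @ [b2]))" using n(1) by (rule path_rev)
  then have "path (last (s @ m @ t) # rev n @ [hd (s @ m @ t)])" using sn s(2) t(3) by simp
  moreover have "set (s @ m @ t) \<inter> set (rev n) = {}"
    using n(4,5) m(4) pq s(4) t(4) by auto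
  moreover have len: "length w1 \<ge> 3" "length w1 = length w2"
    using c w by (auto simp: cyc_def longest_def le_antisym)
  moreover from this have "length (s @ m @ t) \<ge> 3" using s(5) t(5) by simp
  ultimately have "cyc ((s @ m @ t) @ rev n)" using cyc_close[OF st] by blast
  then have "length ((s @ m @ t) @ rev n) \<le> length w1" using w longestD(2) by blast
  then show False using s(5) t(5) len by simp
qed

text \<open>A vertex \<open>v\<close> with the most neighbours in \<open>nbs D\<close> works. If it
  misses \<open>s\<close>, take a shortest path in \<open>D\<close> from \<open>v\<close> to a
  neighbour of \<open>s\<close>: chordality makes its last vertex adjacent to all neighbours of
  \<open>v\<close> in \<open>nbs D\<close>, and to \<open>s\<close> as well, against
  maximality.\<close>

lemma ex_vertex_dominating_nbs:
  assumes D: "D \<subseteq> V" "D \<noteq> {}" "\<And>x y. x \<in> D \<Longrightarrow> y \<in> D \<Longrightarrow> reach D x y" "complete (nbs D)"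
  shows "\<exists>v \<in> D. \<forall>s \<in> nbs D. E v s"
proof -
  have fin: "finite D" "finite (nbs D)"
    using D(1) finite_V by (auto simp: nbs_def intro: finite_subset)
  let ?N = "\<lambda>v. {s \<in> nbs D. E v s}"
  have "Max ((\<lambda>v. card (?N v)) ` D) \<in> (\<lambda>v. card (?N v)) ` D" using fin D(2) by (intro Max_in) auto
  then obtain v where v: "v \<in> D" "card (?N v) = Max ((\<lambda>v. card (?N v)) ` D)" by auto
  have max: "card (?N u) \<le> card (?N v)" if "u \<in> D" for u
    unfolding v(2) using fin that by (intro Max_ge) auto
  have "E v s" if s: "s \<in> nbs D" for s
  proof (rule ccontr)
    assume nvs: "\<not> E v s"
    obtain d where d: "d \<in> D" "E d s" using s by (auto simp: nbs_def)
    define Q where "Q p \<longleftrightarrow> path p \<and> hd p = v \<and> set p \<subseteq> D \<and> E (last p) s" for p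
    have "\<exists>p. Q p" using reach_path[OF D(3)[OF v(1) d(1)] v(1) D(1)] d(2) unfolding Q_def by blast
    then obtain p where p: "Q p" and shortest: "\<And>q. Q q \<Longrightarrow> length p \<le> length q"
      using ex_has_least_nat[of Q _ length] by blast
    have pp: "path p" "p \<noteq> []" "hd p = v" "set p \<subseteq> D" "E (last p) s" "distinct p" "successively E p"
      using p by (auto simp: Q_def path_def)
    \<comment> \<open>An edge that skips vertices of \<open>p\<close> would be a shortcut.\<close>
    have induced: "j = Suc i" if ij: "i < j" "j < length p" "E (p ! i) (p ! j)" for i j
    proof (rule ccontr)
      assume "j \<noteq> Suc i"
      let ?q = "take (Suc i) p @ drop j p"
      have "last (take (Suc i) p) = p ! i" "hd (drop j p) = p ! j"
        using ij by (auto simp: take_Suc_conv_app_nth hd_drop_conv_nth)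
      moreover have "set (take (Suc i) p) \<inter> set (drop j p) = {}"
        using pp(6) ij by (intro set_take_disj_set_drop_if_distinct) auto
      moreover have "path (take (Suc i) p)" "path (drop j p)"
        using pp ij path_appendD[of "take (Suc i) p" "drop (Suc i) p"] path_appendD[of "take j p" "drop j p"]
        by auto
      ultimately have "path ?q" using path_append ij(3) by metis
      moreover have "hd ?q = v" using pp by (cases p) auto
      moreover have "last ?q = last p" using ij by (simp add: last_drop)
      moreover have "set ?q \<subseteq> D" using pp(4) by (auto dest: in_set_takeD in_set_dropD)
      ultimately have "Q ?q" using pp(5) by (simp add: Q_def)
      then show False using shortest[of ?q] ij \<open>j \<noteq> Suc i\<close> by simp
    qed
    have only_last: "Suc i = length p" if i: "i < length p" "E (p ! i) s" for i
    proof -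
      let ?q = "take (Suc i) p"
      have "path ?q" using pp i path_appendD(1)[of ?q "drop (Suc i) p"] by auto
      moreover have "hd ?q = v" using pp by (cases p) auto
      moreover have "last ?q = p ! i" using i by (simp add: take_Suc_conv_app_nth)
      moreover have "set ?q \<subseteq> D" using pp(4) by (auto dest: in_set_takeD)
      ultimately have "Q ?q" using i(2) by (simp add: Q_def)
      then show ?thesis using shortest[of ?q] i by simp
    qed
    have keep: "E (last p) t" if t: "t \<in> nbs D" "E v t" for t
    proof (rule ccontr)
      assume nlt: "\<not> E (last p) t"
      have "\<exists>y \<in> set p. E y t" using t(2) pp(2,3) by (intro bexI[of _ "hd p"]) auto
      then obtain p1 y p2 where y: "p = p1 @ y # p2" "E y t" "\<forall>u \<in> set p2. \<not> E u t"
        by (rule split_list_last_propE)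
      \<comment> \<open>The part of \<open>p\<close> from the last neighbour \<open>y\<close> of
        \<open>t\<close>, closed by \<open>s\<close> and \<open>t\<close>, is a chordless cycle; its
        length is at least 4 because \<open>y\<close> is not the last vertex of
        \<open>p\<close>.\<close>
      define r where "r = y # p2"
      define w where "w = t # r @ [s]"
      have r: "r \<noteq> []" "p = p1 @ r" "last r = last p" by (auto simp: r_def y)
      have "p2 \<noteq> []" using y nlt by auto
      then have len: "length w \<ge> 4" by (cases p2) (auto simp: w_def r_def)
      have st: "s \<noteq> t" "E s t" "E t s" using t nvs s D(4) by (auto simp: complete_def)
      have "path r" using pp(1) r path_appendD(2) by metis
      have sub: "set r \<subseteq> D" "s \<notin> D" "t \<notin> D" "s \<in> V" "t \<in> V"
        using pp(4) r(2) s t(1) by (auto simp: nbs_def)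
      have "cyc w"
        using \<open>path r\<close> sub st E_sym[OF y(2)] pp(5) r(3) len \<open>p2 \<noteq> []\<close>
        unfolding w_def cyc_def cyclically_def path_def
        by (auto simp: successively_append_iff successively_Cons r_def)
      \<comment> \<open>\<open>Z\<close> holds the oriented edges of \<open>w\<close>; every edge
        between vertices of \<open>w\<close> turns out to be one of them up to orientation.\<close>
      define Z where "Z = set (zip w (rotate1 w))"
      have "cyclically (\<lambda>a b. (a, b) \<in> Z) w" by (auto simp: cyclically_conv_zip Z_def)
      then have Z: "(s, t) \<in> Z" "(t, y) \<in> Z" "(last r, s) \<in> Z" "successively (\<lambda>a b. (a, b) \<in> Z) r"
        using r(1) unfolding cyclically_def w_def
        by (simp_all add: successively_append_iff successively_Cons) (simp_all add: r_def)
      have sr: "u = last r" if u: "u \<in> set r" "E u s" for u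
      proof -
        obtain k where k: "k < length r" "u = r ! k" using u(1) by (auto simp: in_set_conv_nth)
        then have "Suc (length p1 + k) = length p"
          using u(2) r(2) by (intro only_last) (auto simp: nth_append)
        then have "Suc k = length r" using r(2) by simp
        then show ?thesis using k r(1) by (metis last_conv_nth diff_Suc_1)
      qed
      have tr: "u = y" if "u \<in> set r" "E u t" for u using that y(3) by (auto simp: r_def)
      have rr: "(r ! i, r ! j) \<in> Z" if "i < j" "j < length r" "E (r ! i) (r ! j)" for i j
      proof -
        have "length p1 + j = Suc (length p1 + i)"
          using that r(2) by (intro induced) (auto simp: nth_append)
        then show ?thesis using successively_nth[OF Z(4), of i] that by simp
      qed
      have "(u, z) \<in> Z \<or> (z, u) \<in> Z" if uz: "u \<in> set w" "z \<in> set w" "E u z" for u z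
      proof -
        have "u \<in> {s, t} \<or> u \<in> set r" "z \<in> {s, t} \<or> z \<in> set r" using uz by (auto simp: w_def)
        then consider "u \<in> {s, t}" "z \<in> {s, t}" | "u \<in> {s, t}" "z \<in> set r" | "u \<in> set r" "z \<in> {s, t}"
          | "u \<in> set r" "z \<in> set r" by blast
        then show ?thesis
        proof cases
          case 1
          then show ?thesis using Z(1) uz(3) E_irrefl by auto
        next
          case 2
          then show ?thesis using Z(2,3) sr[of z] tr[of z] E_sym[OF uz(3)] by auto
        next
          case 3
          then show ?thesis using Z(2,3) sr[of u] tr[of u] uz(3) by auto
        next
          case 4
          then obtain i j where ij: "i < length r" "u = r ! i" "j < length r" "z = r ! j"
            by (auto simp: in_set_conv_nth)
          have "i \<noteq> j" using ij uz(3) E_irrefl by auto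
          then show ?thesis using rr[of i j] rr[of j i] ij uz(3) E_sym[OF uz(3)] by (cases "i < j") auto
        qed
      qed
      then show False using chord[OF \<open>cyc w\<close> len] unfolding Z_def by blast
    qed
    have "?N v \<subset> ?N (last p)" using keep s nvs pp(5) by blast
    then have "card (?N v) < card (?N (last p))" using fin(2) by (intro psubset_card_mono) auto
    moreover have "last p \<in> D" using pp(2,4) last_in_set by blast
    ultimately show False using max by force
  qed
  then show ?thesis using v(1) by blast
qed

section \<open>Descent on traps\<close>

text \<open>The last conjunct says that two longest cycles, indexed by distinct colours, have all their edges
  meet \<open>D\<close> and meet \<open>nbs D\<close> only in vertices of their own colour.\<close>
definition trap :: "nat \<Rightarrow> 'a set \<Rightarrow> ('a \<Rightarrow> nat) \<Rightarrow> bool" where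
  "trap t D c \<longleftrightarrow> D \<subseteq> V \<and> D \<noteq> {} \<and> (\<forall>x \<in> D. \<forall>y \<in> D. reach D x y) \<and> complete (nbs D) \<and>
    (\<forall>x. c x < 3) \<and> (\<forall>i. card {s \<in> nbs D. c s = i} \<le> t) \<and>
    (\<exists>C i j. i \<noteq> j \<and> (\<forall>k \<in> {i, j}. longest (C k) \<and> inside (C k) D \<and> (\<forall>s \<in> set (C k) \<inter> nbs D. c s = k)))"

text \<open>The new trap is a component \<open>D'\<close> outside
  \<open>K = insert v (nbs D)\<close>. It meets \<open>D\<close>, hence lies in \<open>D\<close>,
  and it omits \<open>v\<close>, which makes it smaller.\<close>

lemma smaller_trap:
  assumes trap: "trap t D c" and t: "\<And>K. complete K \<Longrightarrow> card K \<le> 3 * t"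
    and no_transversal: "\<And>F. complete F \<Longrightarrow> card F \<le> 2 * t \<Longrightarrow> \<exists>w. longest w \<and> F \<inter> set w = {}"
  shows "\<exists>D' c'. trap t D' c' \<and> card D' < card D"
proof -
  have D: "D \<subseteq> V" "D \<noteq> {}" "\<And>x y. x \<in> D \<Longrightarrow> y \<in> D \<Longrightarrow> reach D x y" "complete (nbs D)"
    and c: "\<And>x. c x < 3" "\<And>i. card {s \<in> nbs D. c s = i} \<le> t"
    using trap by (auto simp: trap_def)
  obtain C i0 j0 where C: "i0 \<noteq> j0" "\<And>k. k \<in> {i0, j0} \<Longrightarrow> longest (C k)"
    "\<And>k. k \<in> {i0, j0} \<Longrightarrow> inside (C k) D" "\<And>k s. k \<in> {i0, j0} \<Longrightarrow> s \<in> set (C k) \<inter> nbs D \<Longrightarrow> c s = k"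
  proof -
    have "\<exists>C i j. i \<noteq> j \<and>
      (\<forall>k \<in> {i, j}. longest (C k) \<and> inside (C k) D \<and> (\<forall>s \<in> set (C k) \<inter> nbs D. c s = k))"
      using trap by (simp add: trap_def)
    then show thesis by (elim exE conjE) (rule that, auto)
  qed
  obtain v where v: "v \<in> D" "\<forall>s \<in> nbs D. E v s" using ex_vertex_dominating_nbs[OF D] by blast
  define K where "K = insert v (nbs D)"
  have K: "complete K"
    using D(1,4) v E_sym unfolding complete_def K_def by auto
  have fin: "finite (nbs D)" "finite K"
    using finite_V by (auto simp: nbs_def K_def)
  have vN: "v \<notin> nbs D" using v(1) by (simp add: nbs_def)
  have "card K \<le> 3 * t" using t K by blast
  then have "card (nbs D) < 3 * t" using fin vN by (simp add: K_def)
  \<comment> \<open>\<open>K\<close> has the vertex \<open>v\<close> besides \<open>nbs D\<close>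
    and at most \<open>3 * t\<close> vertices in all, so some colour class on \<open>nbs D\<close>
    has room for \<open>v\<close>.\<close>
  have "\<exists>m < 3. card {s \<in> nbs D. c s = m} < t"
  proof (rule ccontr)
    assume "\<not> ?thesis"
    then have "t \<le> card {s \<in> nbs D. c s = k}" if "k < 3" for k using that by force
    from this[of 0] this[of 1] this[of 2] show False
      using card_three_colours[of "nbs D" c, OF fin(1) c(1)] \<open>card (nbs D) < 3 * t\<close> by simp
  qed
  then obtain m where m: "m < 3" "card {s \<in> nbs D. c s = m} < t" by blast
  define c' where "c' = c(v := m)"
  have c'3: "c' x < 3" for x using c(1) m by (simp add: c'_def)
  have classes: "card {s \<in> K. c' s = i} \<le> t" for i
  proof (cases "i = m")
    case True
    then have "{s \<in> K. c' s = i} \<subseteq> insert v {s \<in> nbs D. c s = m}" by (auto simp: K_def c'_def)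
    then have "card {s \<in> K. c' s = i} \<le> card (insert v {s \<in> nbs D. c s = m})"
      using fin by (intro card_mono) auto
    then show ?thesis using m(2) fin by (simp add: card_insert_if split: if_splits)
  next
    case False
    then have "{s \<in> K. c' s = i} = {s \<in> nbs D. c s = i}" using vN by (auto simp: K_def c'_def)
    then show ?thesis using c(2) by simp
  qed
  have "\<exists>w. longest w \<and> (\<forall>s \<in> set w \<inter> K. c' s = i)" if "i < 3" for i
  proof -
    \<comment> \<open>\<open>?F\<close> consists of two colour classes; a longest cycle that misses
      it meets \<open>K\<close> in colour \<open>i\<close> only.\<close>
    let ?F = "{s \<in> K. c' s \<noteq> i}"
    have "complete ?F" using K by (auto simp: complete_def)
    moreover have "card ?F \<le> 2 * t"
    proof -
      define n where "n j = card {s \<in> ?F. c' s = j}" for j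
      have "n j \<le> t" for j
      proof -
        have "n j \<le> card {s \<in> K. c' s = j}" unfolding n_def using fin by (intro card_mono) auto
        then show ?thesis using classes[of j] by linarith
      qed
      moreover have "n i = 0" by (simp add: n_def)
      moreover have "card ?F = n 0 + n 1 + n 2"
        using card_three_colours[of ?F c', OF _ c'3] fin by (simp add: n_def)
      moreover have "i = 0 \<or> i = 1 \<or> i = 2" using that by linarith
      ultimately show ?thesis by (metis add.commute add.right_neutral add_mono mult_2)
    qed
    ultimately obtain w where "longest w" "?F \<inter> set w = {}" using no_transversal by blast
    then show ?thesis by blast
  qed
  then obtain C' where C': "\<And>i. i < 3 \<Longrightarrow> longest (C' i)"
    "\<And>i s. i < 3 \<Longrightarrow> s \<in> set (C' i) \<inter> K \<Longrightarrow> c' s = i"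
    by metis
  define P where "P i \<longleftrightarrow> (\<exists>x \<in> V - K. inside (C' i) (component K x))" for i
  have pair: "P i \<or> P j" if "i < 3" "j < 3" "i \<noteq> j" for i j
  proof -
    have "set (C' i) \<inter> set (C' j) \<inter> K = {}" using C'(2) that by blast
    then show ?thesis
      using longest_cycle_inside_component[OF K C'(1) C'(1)] that unfolding P_def by blast
  qed
  \<comment> \<open>Of any two colours at least one satisfies \<open>P\<close>, so at least two of
    the three do.\<close>
  obtain i j where ij: "i < 3" "j < 3" "i \<noteq> j" "P i" "P j"
  proof -
    have "P 0 \<and> P 1 \<or> P 1 \<and> P 2 \<or> P 0 \<and> P 2"
      using pair[of 0 1] pair[of 1 2] pair[of 0 2] by simp blast
    then show thesis using that[of 0 1] that[of 1 2] that[of 0 2] by auto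
  qed
  obtain x y where x: "x \<in> V - K" "inside (C' i) (component K x)" and y: "y \<in> V - K" "inside (C' j) (component K y)"
    using ij unfolding P_def by blast
  have "component K y = component K x"
  proof -
    obtain z where z: "z \<in> set (C' i)" "z \<in> set (C' j)"
      using longest_cycles_intersect[OF C'(1) C'(1)] ij by blast
    \<comment> \<open>A common vertex in \<open>K\<close> would have both colours \<open>i\<close>
      and \<open>j\<close>.\<close>
    then have "z \<notin> K" using C'(2) ij by blast
    then have "z \<in> component K x" "z \<in> component K y"
      using z inside_subset[OF longestD(1)[OF C'(1)]] x y nbs_component ij(1,2) by blast+
    then show ?thesis using component_eqI by blast
  qed
  define D' where "D' = component K x"
  have in': "inside (C' l) D'" "longest (C' l)" "l < 3" if "l \<in> {i, j}" for l
    using that x y ij C' \<open>component K y = component K x\<close> by (auto simp: D'_def)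
  have D': "D' \<subseteq> V - K" "x \<in> D'" "nbs D' \<subseteq> K"
    using component_subset nbs_component component_self x by (auto simp: D'_def)
  have "trap t D' c'"
    unfolding trap_def
  proof (intro conjI)
    show "D' \<subseteq> V" "D' \<noteq> {}" using D' by auto
    show "\<forall>x \<in> D'. \<forall>y \<in> D'. reach D' x y" using component_connected by (auto simp: D'_def)
    show "complete (nbs D')" using K D'(3) by (auto simp: complete_def)
    show "\<forall>x. c' x < 3" using c'3 by blast
    show "\<forall>i. card {s \<in> nbs D'. c' s = i} \<le> t"
    proof
      fix i
      have "{s \<in> nbs D'. c' s = i} \<subseteq> {s \<in> K. c' s = i}" using D'(3) by auto
      then have "card {s \<in> nbs D'. c' s = i} \<le> card {s \<in> K. c' s = i}" using fin by (intro card_mono) auto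
      then show "card {s \<in> nbs D'. c' s = i} \<le> t" using classes[of i] by linarith
    qed
    show "\<exists>C i j. i \<noteq> j \<and>
      (\<forall>k \<in> {i, j}. longest (C k) \<and> inside (C k) D' \<and> (\<forall>s \<in> set (C k) \<inter> nbs D'. c' s = k))"
    proof -
      have all: "longest (C' k) \<and> inside (C' k) D' \<and> (\<forall>s \<in> set (C' k) \<inter> nbs D'. c' s = k)"
        if "k \<in> {i, j}" for k
        using in'[OF that] C'(2)[of k] D'(3) by blast
      show ?thesis
        by (rule exI[of _ C'], rule exI[of _ i], rule exI[of _ j], rule conjI[OF ij(3) ballI], rule all)
    qed
  qed
  moreover have "card D' < card D"
  proof -
    \<comment> \<open>An edge that leaves \<open>D\<close> ends in \<open>nbs D\<close>, which is
      part of \<open>K\<close>.\<close>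
    have closed: "b \<in> D" if "E a b" "a \<in> D" "b \<notin> K" for a b
      using that E_V2 by (auto simp: K_def nbs_def)
    have "D' \<inter> D \<noteq> {}"
    proof
      assume disj: "D' \<inter> D = {}"
      \<comment> \<open>One colour from the old pair and one from the new pair; they can be chosen
        distinct because the old pair has two colours.\<close>
      obtain k l where kl: "k \<in> {i0, j0}" "l \<in> {i, j}" "k \<noteq> l" using C(1) by blast
      obtain z where z: "z \<in> set (C k)" "z \<in> set (C' l)"
        using longest_cycles_intersect[OF C(2)[OF kl(1)] in'(2)[OF kl(2)]] by blast
      have zD: "z \<in> D \<union> nbs D" "z \<in> D' \<union> nbs D'"
        using z inside_subset[OF longestD(1)[OF C(2)] C(3), OF kl(1) kl(1)]
          inside_subset[OF longestD(1)[OF in'(2)] in'(1), OF kl(2) kl(2)] by blast+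
      show False
      proof (cases "z \<in> D")
        case True
        then have "z \<in> nbs D'" using zD disj by blast
        then obtain d where "d \<in> D'" "E d z" by (auto simp: nbs_def)
        then show False using closed[OF E_sym True] D'(1) disj by blast
      next
        case False
        then have "z \<in> nbs D" using zD by blast
        \<comment> \<open>\<open>c\<close> and \<open>c'\<close> differ only at \<open>v\<close>,
          which is not in \<open>nbs D\<close>.\<close>
        then have "c z = k" "c' z = l" "z \<noteq> v"
          using C(4)[OF kl(1), of z] C'(2)[OF in'(3)[OF kl(2)], of z] z vN by (auto simp: K_def)
        then show False using kl(3) by (simp add: c'_def)
      qed
    qed
    then obtain d where d: "d \<in> D'" "d \<in> D" by blast
    have "D' \<subseteq> D"
    proof
      fix u assume "u \<in> D'"
      then have "reach (- K) d u" using d(1) component_eqI[of d K x] by (simp add: D'_def component_def set_eq_iff)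
      then show "u \<in> D" by (rule reach_closed) (use d(2) closed in auto)
    qed
    moreover have "v \<notin> D'" using D'(1) by (auto simp: K_def)
    ultimately show ?thesis
      using v(1) D(1) finite_V by (intro psubset_card_mono) (auto intro: finite_subset)
  qed
  ultimately show ?thesis by blast
qed

text \<open>Without a transversal every trap yields a smaller one, so no trap exists. Yet the whole
  vertex set is one: \<open>nbs V\<close> is empty, which makes the colour conditions
  vacuous.\<close>

theorem clique_transversal:
  assumes t: "\<And>K. complete K \<Longrightarrow> card K \<le> 3 * t"
  shows "\<exists>F. complete F \<and> card F \<le> 2 * t \<and> (\<forall>w. longest w \<longrightarrow> F \<inter> set w \<noteq> {})"
proof (rule ccontr)
  assume "\<not> ?thesis"
  then have no: "\<exists>w. longest w \<and> F \<inter> set w = {}" if "complete F" "card F \<le> 2 * t" for F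
    using that by blast
  have no_trap: "\<not> trap t D c" for D c
  proof (induction "card D" arbitrary: D c rule: less_induct)
    case less
    then show ?case using smaller_trap[OF _ t no] by blast
  qed
  have "complete {}" by (simp add: complete_def)
  \<comment> \<open>The empty clique is no transversal, so a longest cycle exists.\<close>
  then obtain w where w: "longest w" using no[of "{}"] by auto
  then have "cyc w" by (rule longestD)
  then have "V \<noteq> {}" "inside w V"
    unfolding inside_def by (auto simp: cyc_def intro: cyclically_mono)
  moreover have "nbs V = {}" by (auto simp: nbs_def)
  \<comment> \<open>One cycle stands for both colours 0 and 1, as it has no vertex in
    \<open>nbs V\<close>.\<close>
  moreover have "\<exists>C i j. i \<noteq> (j :: nat) \<and>
      (\<forall>k \<in> {i, j}. longest (C k) \<and> inside (C k) V \<and> (\<forall>s \<in> set (C k) \<inter> nbs V. 0 = k))"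
    by (rule exI[of _ "\<lambda>_. w"], rule exI[of _ 0], rule exI[of _ 1])
      (use w calculation in simp)
  ultimately have "trap t V (\<lambda>_. 0)"
    using conn1 \<open>complete {}\<close> unfolding trap_def by simp
  then show False using no_trap by blast
qed

end

section \<open>Translation between digraphs and vertex lists\<close>

lemma (in graph) simple_graph_dominates: "simple_graph (verts G) (dominates G)"
  by unfold_locales (auto intro: arcs_ends_symmetric[OF sym_arcs] adj_in_verts dest: adj_not_same)

text \<open>\<open>connected\<close> refers to the symmetrised digraph; the induced subgraph is
  symmetric already, hence strongly connected.\<close>

lemma (in graph) reach_if_connected_induce:
  assumes "connected (G \<restriction> X)" "X \<subseteq> verts G" "u \<in> X" "v \<in> X"
  shows "simple_graph.reach (dominates G) X u v"
proof -
  interpret S: simple_graph "verts G" "dominates G" by (rule simple_graph_dominates)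
  interpret I: wf_digraph "G \<restriction> X" by (rule wellformed_induce_subgraph)
  have "symmetric (G \<restriction> X)"
    using induced_graph_imp_symmetric[OF sym_arcs induced_induce[OF assms(2)]] .
  then have "strongly_connected (G \<restriction> X)"
    using I.symmetric_connected_imp_strongly_connected assms(1) by blast
  then have "u \<rightarrow>\<^sup>*\<^bsub>G \<restriction> X\<^esub> v" using assms by (auto simp: strongly_connected_def)
  then show ?thesis
  proof (induction rule: I.reachable_induct)
    case base
    show ?case by (rule S.reach_refl)
  next
    case (step x y)
    have "x \<in> X" "y \<in> X" using I.adj_in_verts[OF step.hyps(2)] by auto
    then show ?case using S.reach_step step dominates_induce_subgraphD by metis
  qed
qed

lemma (in graph) awalk_tails:
  assumes "awalk u p v" "p \<noteq> []"
  shows "hd (map (tail G) p) = u \<and> successively (dominates G) (map (tail G) p) \<and>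
    last (map (tail G) p) \<rightarrow>\<^bsub>G\<^esub> v"
  using assms
proof (induction p arbitrary: u)
  case (Cons e p)
  then have e: "e \<in> arcs G" "tail G e = u" "awalk (head G e) p v" by (auto simp: awalk_Cons_iff)
  then have "tail G e \<rightarrow>\<^bsub>G\<^esub> head G e" by (auto simp: arcs_ends_conv)
  then show ?case
    using Cons.IH[OF e(3)] e by (cases "p = []") (auto simp: successively_Cons awalk_Nil_iff)
qed simp

text \<open>\<open>cycle\<close> makes the heads of the arcs distinct. On a closed walk the tails
  form the same set, and being equally many, they are distinct too.\<close>

lemma (in graph) cyc_if_ucycle:
  assumes "ucycle G p"
  shows "simple_graph.cyc (verts G) (dominates G) (map (tail G) p)"
proof -
  interpret S: simple_graph "verts G" "dominates G" by (rule simple_graph_dominates)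
  obtain u where u: "awalk u p u" "distinct (tl (awalk_verts u p))" "p \<noteq> []" "length p \<ge> 3"
    using assms by (auto simp: ucycle_def cycle_def)
  have cas: "cas u p u" using u(1) by auto
  note tails = awalk_tails[OF u(1,3)]
  have heads: "awalk_verts u p = u # map (head G) p"
    using awalk_verts_conv'[OF cas] u(3) tails by (cases p) auto
  then have d: "distinct (map (head G) p)" using u(2) by simp
  have eq: "map (tail G) p @ [head G (last p)] = u # map (head G) p"
    using heads awalk_verts_conv[of u p] u(3) by simp
  have "last (u # map (head G) p) = u" using awlast_if_cas[OF cas] heads by simp
  then have "u \<in> set (map (head G) p)" using u(3) last_in_set[of "map (head G) p"] by simp
  moreover have "u \<in> set (map (tail G) p)" using tails u(3) hd_in_set[of "map (tail G) p"] by simp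
  moreover have "head G (last p) = u" using arg_cong[OF eq, of last] \<open>last _ = u\<close> by simp
  moreover from this have "insert u (set (map (tail G) p)) = insert u (set (map (head G) p))"
    using arg_cong[OF eq, of set] by simp
  ultimately have "set (map (tail G) p) = set (map (head G) p)" by (metis insert_absorb)
  then have "distinct (map (tail G) p)" using d by (metis card_distinct distinct_card length_map)
  moreover have "set (map (tail G) p) \<subseteq> verts G" using u(1) by (auto simp: awalk_def)
  ultimately show ?thesis using tails u(3,4) by (simp add: S.cyc_def cyclically_def)
qed

lemma (in graph) cas_if_arc_ends_zip:
  assumes "map (arc_to_ends G) q = zip (x # xs) (xs @ [y])"
  shows "cas x q y"
  using assms
proof (induction xs arbitrary: x q)
  case Nil
  then show ?case by (cases q) (auto simp: arc_to_ends_def)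
next
  case (Cons a xs)
  then obtain e q' where q: "q = e # q'" by (cases q) auto
  then have "arc_to_ends G e = (x, a)" "map (arc_to_ends G) q' = zip (a # xs) (xs @ [y])"
    using Cons.prems by auto
  then show ?case using Cons.IH[of q' a] q by (simp add: arc_to_ends_def[of _ e])
qed

text \<open>An arc is chosen for each cyclic pair of \<open>w\<close>. The third conclusion
  transfers chords.\<close>

lemma (in graph) ucycle_if_cyc:
  assumes "simple_graph.cyc (verts G) (dominates G) w"
  obtains q where "ucycle G q" "cycle_verts G q = set w" "arc_to_ends G ` set q = set (zip w (rotate1 w))"
proof -
  interpret S: simple_graph "verts G" "dominates G" by (rule simple_graph_dominates)
  have w: "length w \<ge> 3" "distinct w" "set w \<subseteq> verts G" "cyclically (dominates G) w"
    using assms by (auto simp: S.cyc_def)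
  obtain x xs where x: "w = x # xs" using w(1) by (cases w) auto
  have "\<forall>uv \<in> set (zip w (rotate1 w)). uv \<in> arc_to_ends G ` arcs G"
    using w(4) unfolding cyclically_conv_zip arcs_ends_def by auto
  then have "zip w (rotate1 w) \<in> lists (arc_to_ends G ` arcs G)" by (simp add: in_lists_conv_set)
  then obtain q where q: "set q \<subseteq> arcs G" "map (arc_to_ends G) q = zip w (rotate1 w)"
    unfolding lists_image unfolding lists_eq_set by (elim imageE CollectE) (rule that, simp_all)
  have len: "length q = length w" using arg_cong[OF q(2), of length] by simp
  have tails: "map (tail G) q = w"
    using arg_cong[OF q(2), of "map fst"] by (simp add: arc_to_ends_def comp_def)
  have heads: "map (head G) q = rotate1 w"
    using arg_cong[OF q(2), of "map snd"] by (simp add: arc_to_ends_def comp_def)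
  have cas: "cas x q x" using q(2) x by (intro cas_if_arc_ends_zip[of q x xs]) simp
  then have "awalk x q x" using q(1) w(3) x by (simp add: awalk_def)
  moreover have "distinct (tl (awalk_verts x q))"
    using awalk_verts_conv'[OF cas] heads w(2) by simp
  ultimately have "ucycle G q" using len w(1) unfolding ucycle_def cycle_def by auto
  moreover have "cycle_verts G q = set w" unfolding cycle_verts_def tails[symmetric] by simp
  moreover have "arc_to_ends G ` set q = set (zip w (rotate1 w))" unfolding q(2)[symmetric] by simp
  ultimately show thesis by (rule that)
qed

lemma (in graph) biconnected_chordal_dominates:
  assumes "k_connected 2 G" "chordal G"
  shows "biconnected_chordal (verts G) (dominates G)"
proof -
  interpret S: simple_graph "verts G" "dominates G" by (rule simple_graph_dominates)
  have conn: "connected (G \<restriction> (verts G - S))" if "S \<subseteq> verts G" "card S < 2" for S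
    using assms(1) that by (simp add: k_connected_def)
  show ?thesis
  proof
    fix x y assume "x \<in> verts G" "y \<in> verts G"
    then show "S.reach (verts G) x y" using conn[of "{}"] by (intro reach_if_connected_induce) auto
  next
    fix x y z assume "x \<in> verts G" "y \<in> verts G - {x}" "z \<in> verts G - {x}"
    then show "S.reach (verts G - {x}) y z" using conn[of "{x}"] by (intro reach_if_connected_induce) auto
  next
    fix w assume w: "S.cyc w" "length w \<ge> 4"
    obtain q where q: "ucycle G q" "cycle_verts G q = set w"
      "arc_to_ends G ` set q = set (zip w (rotate1 w))"
      using ucycle_if_cyc[OF w(1)] .
    have "card (set w) \<ge> 4" using w by (simp add: S.cyc_def distinct_card)
    then have "has_chord G q" using assms(2) q by (simp add: chordal_def)
    then show "\<exists>u \<in> set w. \<exists>v \<in> set w. u \<rightarrow>\<^bsub>G\<^esub> v \<and>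
      (u, v) \<notin> set (zip w (rotate1 w)) \<and> (v, u) \<notin> set (zip w (rotate1 w))"
      using q(2,3) by (simp add: has_chord_def)
  qed
qed

theorem theorem2:
  fixes G :: "('a, 'b) pre_digraph"
  assumes "graph G"
    and "k_connected 2 G"
    and "chordal G"
  shows "\<exists>F \<subseteq> verts G.
           int (card F) \<le> 2 * \<lceil>real (clique_number G) / 3\<rceil> \<and>
           (\<forall>p. longest_cycle G p \<longrightarrow> F \<inter> cycle_verts G p \<noteq> {}) \<and>
           clique G F"
proof -
  interpret graph G by fact
  interpret S: biconnected_chordal "verts G" "\<lambda>u v. u \<rightarrow>\<^bsub>G\<^esub> v"
    using assms by (intro biconnected_chordal_dominates)
  have clique: "clique G K \<longleftrightarrow> S.complete K" for K
    by (simp add: clique_def S.complete_def)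
  \<comment> \<open>\<open>?t\<close> is the ceiling of a third of the clique number, as a natural
    number.\<close>
  let ?n = "clique_number G" and ?t = "(clique_number G + 2) div 3"
  have "card K \<le> 3 * ?t" if "S.complete K" for K
  proof -
    have "finite {C. clique G C}"
      by (rule finite_subset[of _ "Pow (verts G)"]) (auto simp: clique_def)
    moreover have "K \<in> {C. clique G C}" using that clique by simp
    ultimately have "card K \<le> ?n" unfolding clique_number_def by (intro Max_ge finite_imageI imageI)
    also have "?n \<le> 3 * ?t" by presburger
    finally show ?thesis .
  qed
  then obtain F where F: "S.complete F" "card F \<le> 2 * ?t" "\<And>w. S.longest w \<Longrightarrow> F \<inter> set w \<noteq> {}"
    using S.clique_transversal[of ?t] by blast
  have "3 * (int ?t - 1) < int ?n" by presburger
  then have "real_of_int (int ?t - 1) < real ?n / 3" by linarith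
  then have "int ?t \<le> \<lceil>real ?n / 3\<rceil>" by (simp only: less_ceiling_iff[symmetric])
  then have "int (card F) \<le> 2 * \<lceil>real ?n / 3\<rceil>" using F(2) by linarith
  moreover have "F \<inter> cycle_verts G p \<noteq> {}" if p: "longest_cycle G p" for p
  proof -
    have c: "S.cyc (map (tail G) p)" using p by (intro cyc_if_ucycle) (simp add: longest_cycle_def)
    \<comment> \<open>In \<open>G\<close> cycles are compared by their vertex sets, here by list
      length; the two agree on distinct lists.\<close>
    have "length w \<le> length (map (tail G) p)" if w: "S.cyc w" for w
    proof -
      obtain q where "ucycle G q" "cycle_verts G q = set w" using ucycle_if_cyc[OF w] .
      then have "card (set w) \<le> card (set (map (tail G) p))"
        using p by (auto simp: longest_cycle_def cycle_verts_def)
      then show ?thesis using w c by (simp add: S.cyc_def distinct_card del: set_map)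
    qed
    then have "S.longest (map (tail G) p)" using c by (simp add: S.longest_def)
    then show ?thesis using F(3)[of "map (tail G) p"] by (simp add: cycle_verts_def)
  qed
  moreover have "F \<subseteq> verts G" using F(1) by (simp add: S.complete_def)
  ultimately show ?thesis using F(1) clique by blast
qed

end
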